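(* Let $s,\ell$ be integers with $1\le s\le\ell$ and $\ell>1$. For integers $n\ge\ell$ and $k\ge1$, let $C^{(\ell,s)}_{n,k}$ denote the number of cycles of length $s$ of $\big((1\,2\,\cdots\,\ell)\big)^{\odot k}$, where $(1\,2\,\cdots\,\ell)\in\mathfrak{S}_n$ is the $\ell$-cycle fixing $\ell+1,\dots,n$. Then $$C^{(\ell,s)}_{n,k}=\begin{cases}1 & \text{if } k=1 \text{ and } s=\ell,\\ n-\ell & \text{if } k=1\text{ and } s=1,\\ 0 & \text{if } k=1 \text{ and } s\notin\{1,\ell\},\\ \displaystyle\left[s\mid\ell \text{ and } \tfrac{\ell}{s}\mid k\right]\frac{\ell}{s\ell+sk}\sum_{e\mid \gcd(s,\,sk/\ell)}\mu(e)\binom{(s+sk/\ell)/e}{s/e} & \text{if } k>1 \text{ and } n=\ell,\\ C^{(\ell,s)}_{n-1,k}+C^{(\ell,s)}_{n,k-1} & \text{otherwise (i.e. } k>1,\ n>\ell).\end{cases}$$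
   Context: For positive integers $n,k$, let $\mathcal{C}_{n,k}$ be the set of weakly increasing $k$-tuples $(i_1\le\cdots\le i_k)$ with entries in $[n]$ (equivalently, $k$-element multisets from $[n]$). For $\sigma\in\mathfrak{S}_n$, the $k$-th symmetric tensor power $\sigma^{\odot k}$ is the permutation of $\mathcal{C}_{n,k}$ sending $(i_1,\dots,i_k)$ to the weakly increasing rearrangement of $(\sigma(i_1),\dots,\sigma(i_k))$ (equivalently, the permutation given by the $k$-th symmetric tensor power of the permutation matrix of $\sigma$). $[P]$ is the Iverson bracket ($1$ if $P$ is true, $0$ otherwise; when it is $0$ the whole expression is $0$), and $\mu$ is the number-theoretic Möbius function. *)

theory Defs
  imports
    Complex_Main
    "HOL-Computational_Algebra.Squarefree"
    "HOL-Combinatorics.Cycles"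
    "HOL-Combinatorics.Orbits"
begin

definition weak_tuples :: "nat \<Rightarrow> nat \<Rightarrow> nat list set" where
  "weak_tuples n k = {xs. length xs = k \<and> sorted xs \<and> set xs \<subseteq> {1..n}}"

text \<open>
  Extended by the identity outside \<open>weak_tuples n k\<close>, following the convention of
  \<^const>\<open>permutes\<close>.
\<close>

definition sym_power :: "nat \<Rightarrow> nat \<Rightarrow> (nat \<Rightarrow> nat) \<Rightarrow> nat list \<Rightarrow> nat list" where
  "sym_power n k \<sigma> xs = (if xs \<in> weak_tuples n k then sort (map \<sigma> xs) else xs)"

lemma finite_weak_tuples: "finite (weak_tuples n k)"
  by (rule finite_subset[OF _ finite_lists_length_eq[of "{1..n}" k]])
    (auto simp: weak_tuples_def)

lemma sym_power_permutes:
  assumes "\<sigma> permutes {1..n}"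
  shows "sym_power n k \<sigma> permutes weak_tuples n k"
proof (rule bij_imp_permutes)
  have inj: "inj_on (sym_power n k \<sigma>) (weak_tuples n k)"
  proof (rule inj_onI)
    fix xs ys
    assume xs: "xs \<in> weak_tuples n k" and ys: "ys \<in> weak_tuples n k"
      and "sym_power n k \<sigma> xs = sym_power n k \<sigma> ys"
    then have "mset (sort (map \<sigma> xs)) = mset (sort (map \<sigma> ys))"
      by (simp add: sym_power_def)
    then have "image_mset \<sigma> (mset xs) = image_mset \<sigma> (mset ys)"
      by simp
    then have "mset xs = mset ys"
      using permutes_inj[OF assms] by (metis multiset.inj_map_strong injD)
    then show "xs = ys"
      using xs ys by (metis (mono_tags, lifting) mem_Collect_eq properties_for_sort weak_tuples_def)
  qed
  have "sym_power n k \<sigma> ` weak_tuples n k \<subseteq> weak_tuples n k"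
    using permutes_in_image[OF assms] by (fastforce simp: sym_power_def weak_tuples_def)
  then show "bij_betw (sym_power n k \<sigma>) (weak_tuples n k) (weak_tuples n k)"
    using inj by (simp add: bij_betw_def endo_inj_surj finite_weak_tuples)
qed (simp add: sym_power_def)

text \<open>
  A cycle of \<open>f\<close> on \<open>S\<close> is identified with the set of its entries; fixed points in \<open>S\<close>
  count as cycles of length 1.
\<close>

definition num_cycles :: "('a \<Rightarrow> 'a) \<Rightarrow> 'a set \<Rightarrow> nat \<Rightarrow> nat" where
  "num_cycles f S s = card {Z. Z \<subseteq> S \<and> cyclic_on f Z \<and> card Z = s}"

definition cycle_count :: "nat \<Rightarrow> nat \<Rightarrow> nat \<Rightarrow> nat \<Rightarrow> nat" where
  "cycle_count l s n k =
     num_cycles (sym_power n k (cycle_of_list [1..<Suc l])) (weak_tuples n k) s"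

lemma cycle_of_list_permutes:
  assumes "l \<le> n"
  shows "cycle_of_list [1..<Suc l] permutes {1..n}"
  by (rule permutes_subset[OF cycle_permutes]) (use assms in auto)

definition moebius_mu :: "nat \<Rightarrow> int" where
  "moebius_mu n = (if squarefree n then (-1) ^ card (prime_factors n) else 0)"

end

theory Submission
  imports Defs
begin

text \<open>
  A permutation with \<open>c\<close> cycles of length \<open>s\<close> has \<open>s * c\<close> points whose orbit has \<open>s\<close> elements.
  For \<open>n = l\<close> the \<open>l\<close>-cycle rotates multiplicity functions on \<open>l\<close> residues. For \<open>d dvd l\<close> those
  fixed by the \<open>d\<close>-th power are the \<open>d\<close>-periodic ones, which stars and bars counts; Moebius
  inversion over the divisors of \<open>s\<close> isolates the functions of least period \<open>s\<close>.
  For \<open>n > l\<close> the entry \<open>n\<close> is fixed, so the tuples avoiding \<open>n\<close> and the tuples containing \<open>n\<close>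
  (with one \<open>n\<close> removed) give the two terms of the recursion.
\<close>

section \<open>Orbit sizes of a permutation and their transport along injections\<close>

lemma mult_num_cycles:
  assumes "permutation f" and "finite S" and S: "f ` S \<subseteq> S"
  shows "s * num_cycles f S s = card {x \<in> S. card (orbit f x) = s}"
proof -
  let ?C = "{Z. Z \<subseteq> S \<and> cyclic_on f Z \<and> card Z = s}"
  have orbit_subset: "orbit f x \<subseteq> S" if "x \<in> S" for x
  proof
    fix y assume "y \<in> orbit f x"
    then show "y \<in> S" by induction (use that S in auto)
  qed
  \<comment> \<open>A cyclic set is the orbit of each of its points. This yields both the union here
    and the pairwise disjointness below.\<close>
  have union: "\<Union>?C = {x \<in> S. card (orbit f x) = s}"
  proof (intro equalityI subsetI)
    fix x assume "x \<in> {x \<in> S. card (orbit f x) = s}"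
    then have "orbit f x \<in> ?C" and "x \<in> orbit f x"
      using orbit_subset cyclic_on_orbit' permutation_self_in_orbit assms(1) by auto
    then show "x \<in> \<Union>?C" by blast
  qed (auto simp: orbit_cyclic_eq3)
  have "s * card ?C = card (\<Union>?C)"
  proof (rule card_partition)
    show "finite ?C" using assms(2) by simp
    show "finite (\<Union>?C)" unfolding union using assms(2) by simp
  next
    fix Y Z assume "Y \<in> ?C" "Z \<in> ?C" "Y \<noteq> Z"
    then show "Y \<inter> Z = {}" by (metis (lifting) disjoint_iff mem_Collect_eq orbit_cyclic_eq3)
  qed simp
  then show ?thesis by (simp add: num_cycles_def union)
qed

text \<open>The orbit size is the first positive return time \<open>d\<close> of \<open>x\<close>:
  \<open>f ^^ j\<close> acts on \<open>x\<close> through \<open>j mod d\<close>, and no positive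
  exponent below \<open>d\<close> brings \<open>x\<close> back.\<close>

lemma funpow_eq_self_iff_card_orbit_dvd:
  assumes "permutation f"
  shows "(f ^^ j) x = x \<longleftrightarrow> card (orbit f x) dvd j"
proof -
  define d where "d = funpow_dist1 f x x"
  have x: "x \<in> orbit f x" using assms by (rule permutation_self_in_orbit)
  have fd: "(f ^^ d) x = x" unfolding d_def using x by (rule funpow_dist1_prop)
  \<comment> \<open>The iterates of \<open>x\<close> with exponents below \<open>d\<close> are
    distinct and exhaust the orbit.\<close>
  have "card (orbit f x) = d"
    unfolding d_def orbit_conv_funpow_dist1[OF x]
    by (subst card_image[OF inj_on_funpow_dist1[OF x]]) simp
  moreover have "(f ^^ j) x = (f ^^ (j mod d)) x"
    using fd by (rule funpow_mod_eq[symmetric])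
  moreover have "(f ^^ (j mod d)) x = x \<longleftrightarrow> j mod d = 0"
    using funpow_dist1_least[of "j mod d" f x x] unfolding d_def
    by (metis eq_id_iff funpow_0 mod_less_divisor neq0_conv zero_less_Suc)
  ultimately show ?thesis by (simp add: dvd_eq_mod_eq_0)
qed

lemma card_orbit_semiconj:
  assumes inj: "inj_on h S" and S: "g ` S \<subseteq> S"
    and semiconj: "\<And>y. y \<in> S \<Longrightarrow> f (h y) = h (g y)"
    and x: "x \<in> S" and self: "x \<in> orbit g x"
  shows "card (orbit f (h x)) = card (orbit g x)"
proof -
  have sub: "orbit g x \<subseteq> S"
  proof
    fix y assume "y \<in> orbit g x"
    then show "y \<in> S" by induction (use x S in auto)
  qed
  have "h ` orbit g x = orbit f (h x)"
    using self semiconj sub by (intro orbit_inverse) auto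
  then show ?thesis using card_image[OF inj_on_subset[OF inj sub]] by simp
qed

text \<open>Orbits correspond under an equivariant injection. The instances needed are
  \<open>h\<close> forming singletons (\<open>k = 1\<close>), \<open>h\<close> appending
  \<open>n\<close>, and \<open>h\<close> the identity, where \<open>f\<close> and \<open>g\<close>
  agree on \<open>S\<close> but may differ elsewhere.\<close>

lemma card_orbit_semiconj_image:
  assumes inj: "inj_on h S" and S: "g ` S \<subseteq> S" and "permutation g"
    and semiconj: "\<And>y. y \<in> S \<Longrightarrow> f (h y) = h (g y)"
  shows "card {x \<in> h ` S. card (orbit f x) = s} = card {x \<in> S. card (orbit g x) = s}"
proof -
  have "card (orbit f (h x)) = card (orbit g x)" if "x \<in> S" for x
    using card_orbit_semiconj[OF inj S semiconj that] permutation_self_in_orbit assms(3) by metis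
  then have "{x \<in> h ` S. card (orbit f x) = s} = h ` {x \<in> S. card (orbit g x) = s}"
    by auto
  moreover have "inj_on h {x \<in> S. card (orbit g x) = s}"
    using inj by (rule inj_on_subset) auto
  ultimately show ?thesis by (simp add: card_image)
qed

section \<open>The Moebius function and inversion over orbit sizes\<close>

lemma moebius_mu_prime_mult:
  assumes p: "prime p" and d: "\<not> p dvd d"
  shows "moebius_mu (p * d) = - moebius_mu d"
proof (cases "squarefree d")
  case True
  have "d \<noteq> 0" using d by (metis dvd_0_right)
  have "coprime p d" using p d by (simp add: prime_imp_coprime)
  then have "squarefree (p * d)"
    using True p by (intro squarefree_mult_coprime) (auto intro: squarefree_prime)
  moreover have "prime_factors (p * d) = insert p (prime_factors d)"
    using p \<open>d \<noteq> 0\<close> by (simp add: prime_factors_product prime_prime_factors)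
  moreover have "p \<notin> prime_factors d" using d by auto
  ultimately show ?thesis using True by (simp add: moebius_mu_def)
next
  case False
  then have "\<not> squarefree (p * d)" using squarefree_mono[of d "p * d"] by auto
  then show ?thesis using False by (simp add: moebius_mu_def)
qed

text \<open>For \<open>n > 1\<close> fix a prime \<open>p\<close> dividing \<open>n\<close>. Only
  squarefree divisors contribute, and multiplication by \<open>p\<close> pairs those prime to
  \<open>p\<close> (the set \<open>A\<close>) with those divisible by \<open>p\<close> (the set
  \<open>B\<close>), with opposite signs.\<close>

lemma sum_moebius_mu_divisors:
  assumes "n > 0"
  shows "(\<Sum>d | d dvd n. moebius_mu d) = of_bool (n = 1)"
proof (cases "n = 1")
  case True
  then show ?thesis by (simp add: moebius_mu_def)
next
  case False
  then obtain p where p: "prime p" "p dvd n" using prime_factor_nat by blast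
  define A where "A = {d. d dvd n \<and> squarefree d \<and> \<not> p dvd d}"
  define B where "B = {d. d dvd n \<and> squarefree d \<and> p dvd d}"
  have fin: "finite {d. d dvd n}" using assms by (simp add: finite_divisors_nat)
  have B: "B = (*) p ` A"
  proof (intro equalityI subsetI)
    fix b assume b: "b \<in> B"
    then obtain d where d: "b = p * d" unfolding B_def by auto
    \<comment> \<open>Otherwise the square of \<open>p\<close> would divide the squarefree number
      \<open>b\<close>.\<close>
    have "\<not> p dvd d"
    proof
      assume "p dvd d"
      then have "p ^ 2 dvd b" using d by (simp add: power2_eq_square mult_dvd_mono)
      then have "is_unit p" using b unfolding B_def squarefree_def by blast
      then show False using p by auto
    qed
    moreover have "squarefree d" "d dvd n"
      using b d squarefree_mono[of d b] unfolding B_def by (auto dest: dvd_mult_right)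
    ultimately show "b \<in> (*) p ` A" using d unfolding A_def by auto
  next
    fix b assume "b \<in> (*) p ` A"
    then obtain d where d: "b = p * d" "d dvd n" "squarefree d" "\<not> p dvd d"
      unfolding A_def by auto
    have "coprime p d" using p d by (simp add: prime_imp_coprime)
    moreover have "squarefree p" using p by (intro squarefree_prime) simp
    ultimately have "squarefree (p * d)" "p * d dvd n"
      using d p by (blast intro: squarefree_mult_coprime divides_mult)+
    then show "b \<in> B" using d unfolding B_def by simp
  qed
  have "(\<Sum>d | d dvd n. moebius_mu d) = (\<Sum>d\<in>A \<union> B. moebius_mu d)"
    by (rule sum.mono_neutral_right) (use fin in \<open>auto simp: A_def B_def moebius_mu_def\<close>)
  also have "\<dots> = (\<Sum>d\<in>A. moebius_mu d) + (\<Sum>d\<in>B. moebius_mu d)"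
    by (rule sum.union_disjoint) (use fin in \<open>auto simp: A_def B_def\<close>)
  also have "(\<Sum>d\<in>B. moebius_mu d) = (\<Sum>d\<in>A. moebius_mu (p * d))"
    unfolding B using p by (subst sum.reindex) (auto simp: inj_on_def)
  also have "\<dots> = - (\<Sum>d\<in>A. moebius_mu d)"
    unfolding sum_negf[symmetric]
    by (rule sum.cong) (use p in \<open>auto simp: A_def moebius_mu_prime_mult\<close>)
  finally show ?thesis using False by simp
qed

text \<open>Moebius inversion is done pointwise: for a point with orbit size \<open>c\<close>, the
  \<open>e\<close> that contribute are those with \<open>c dvd s div e\<close>. If
  \<open>c dvd s\<close>, these are the divisors of \<open>s / c\<close>, whose Moebius sum is 1
  exactly when \<open>c = s\<close>. Summing over \<open>S\<close> and swapping the sums gives the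
  claim.\<close>

lemma card_orbit_card_eq_sum_moebius_mu:
  assumes "permutation f" and "finite S" and "s > 0"
  shows "int (card {x \<in> S. card (orbit f x) = s}) =
    (\<Sum>e | e dvd s. moebius_mu e * int (card {x \<in> S. (f ^^ (s div e)) x = x}))"
proof -
  let ?D = "{e. e dvd s}" and ?c = "\<lambda>x. card (orbit f x)"
  have fin: "finite ?D" using assms(3) by (simp add: finite_divisors_nat)
  have point: "(\<Sum>e\<in>?D. moebius_mu e * of_bool ((f ^^ (s div e)) x = x)) = of_bool (?c x = s)"
    for x
  proof (cases "?c x dvd s")
    case True
    then obtain q where q: "s = ?c x * q" ..
    then have pos: "?c x > 0" "q > 0" using assms(3) by auto
    have *: "{e. e dvd s \<and> ?c x dvd s div e} = {e. e dvd q}"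
    proof (intro equalityI subsetI)
      fix e assume "e \<in> {e. e dvd s \<and> ?c x dvd s div e}"
      then obtain a b where "s = e * a" "a = ?c x * b" "e > 0"
        using assms(3) by (auto elim!: dvdE)
      then show "e \<in> {e. e dvd q}" using q pos by auto
    next
      fix e assume "e \<in> {e. e dvd q}"
      then obtain a where "q = e * a" by (auto elim!: dvdE)
      then show "e \<in> {e. e dvd s \<and> ?c x dvd s div e}" using q pos by auto
    qed
    have "(\<Sum>e\<in>?D. moebius_mu e * of_bool ((f ^^ (s div e)) x = x)) =
        (\<Sum>e | e dvd s \<and> ?c x dvd s div e. moebius_mu e)"
      unfolding funpow_eq_self_iff_card_orbit_dvd[OF assms(1)]
      by (rule sum.mono_neutral_cong_right) (use fin in auto)
    also have "\<dots> = of_bool (q = 1)" unfolding * using pos(2) by (rule sum_moebius_mu_divisors)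
    also have "q = 1 \<longleftrightarrow> ?c x = s" using q pos by auto
    finally show ?thesis .
  next
    case False
    \<comment> \<open>An orbit size that does not divide \<open>s\<close> divides no divisor of
      \<open>s\<close>, so every term vanishes.\<close>
    have "\<not> ?c x dvd s div e" if "e dvd s" for e
      using False that by (metis dvd_mult dvd_mult_div_cancel)
    then show ?thesis
      unfolding funpow_eq_self_iff_card_orbit_dvd[OF assms(1)] using False
      by (intro trans[OF sum.neutral]) auto
  qed
  have card: "int (card {x \<in> S. P x}) = (\<Sum>x\<in>S. of_bool (P x))" for P
    using assms(2) by (simp add: of_bool_def sum.If_cases Int_def)
  have "int (card {x \<in> S. ?c x = s}) =
      (\<Sum>x\<in>S. \<Sum>e\<in>?D. moebius_mu e * of_bool ((f ^^ (s div e)) x = x))"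
    unfolding card point ..
  also have "\<dots> = (\<Sum>e\<in>?D. moebius_mu e * int (card {x \<in> S. (f ^^ (s div e)) x = x}))"
    unfolding card sum_distrib_left by (rule sum.swap)
  finally show ?thesis .
qed

section \<open>Symmetric powers as permutations, and powers of the cycle\<close>

lemma permutation_sym_power:
  assumes "\<sigma> permutes {1..n}"
  shows "permutation (sym_power n k \<sigma>)"
  using sym_power_permutes[OF assms] finite_weak_tuples permutation_permutes by blast

lemma sym_power_image:
  assumes "\<sigma> permutes {1..n}"
  shows "sym_power n k \<sigma> ` weak_tuples n k \<subseteq> weak_tuples n k"
  using permutes_image[OF sym_power_permutes[OF assms]] by simp

lemma mult_cycle_count:
  assumes "l \<le> n"
  shows "s * cycle_count l s n k =
    card {xs \<in> weak_tuples n k. card (orbit (sym_power n k (cycle_of_list [1..<Suc l])) xs) = s}"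
  unfolding cycle_count_def
  by (intro mult_num_cycles permutation_sym_power sym_power_image finite_weak_tuples
      cycle_of_list_permutes assms)

text \<open>Writing entries as \<open>Suc i\<close> with \<open>i < l\<close> turns the cycle into
  addition of 1 modulo \<open>l\<close>; the formula is the \<open>i\<close>-th entry of the rotated
  list.\<close>

lemma funpow_cycle_of_list:
  assumes "i < l"
  shows "(cycle_of_list [1..<Suc l] ^^ d) (Suc i) = Suc ((d + i) mod l)"
proof -
  have "map (cycle_of_list [1..<Suc l] ^^ d) [1..<Suc l] = rotate d [1..<Suc l]"
    by (intro cyclic_rotation) simp
  from arg_cong[OF this, of "\<lambda>xs. xs ! i"] show ?thesis
    using assms mod_less_divisor[of l "d + i"]
    by (simp add: nth_rotate del: upt_Suc mod_less_divisor)
qed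

text \<open>The exponents that return \<open>Suc i\<close> to itself are the multiples of the orbit
  size and also the multiples of \<open>l\<close>; numbers with the same multiples are
  equal.\<close>

lemma card_orbit_cycle_of_list:
  assumes "i < l"
  shows "card (orbit (cycle_of_list [1..<Suc l]) (Suc i)) = l"
proof -
  let ?\<sigma> = "cycle_of_list [1..<Suc l]"
  have "card (orbit ?\<sigma> (Suc i)) dvd j \<longleftrightarrow> l dvd j" for j
  proof -
    have "card (orbit ?\<sigma> (Suc i)) dvd j \<longleftrightarrow> (?\<sigma> ^^ j) (Suc i) = Suc i"
      by (rule funpow_eq_self_iff_card_orbit_dvd[symmetric]) (rule permutation_of_cycle)
    also have "\<dots> \<longleftrightarrow> (j + i) mod l = (0 + i) mod l"
      unfolding funpow_cycle_of_list[OF assms] using assms by simp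
    also have "\<dots> \<longleftrightarrow> l dvd j"
      by (metis add_diff_cancel_right' diff_zero le_add2 mod_eq_dvd_iff_nat add_0)
    finally show ?thesis .
  qed
  then show ?thesis by (meson dvd_antisym dvd_refl)
qed

section \<open>The case k = 1\<close>

lemma weak_tuples_1: "weak_tuples n 1 = (\<lambda>i. [i]) ` {1..n}"
  by (auto simp: weak_tuples_def length_Suc_conv)

text \<open>On singletons the symmetric power is the cycle itself, with one orbit of
  \<open>l\<close> points and \<open>n - l\<close> fixed points; \<open>1 < l\<close> keeps the two
  orbit sizes apart.\<close>

lemma mult_cycle_count_1:
  assumes "1 < l" "l \<le> n"
  shows "s * cycle_count l s n 1 = (if s = l then l else if s = 1 then n - l else 0)"
proof -
  let ?\<sigma> = "cycle_of_list [1..<Suc l]"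
  have \<sigma>: "?\<sigma> permutes {1..n}" using assms by (intro cycle_of_list_permutes)
  have "s * cycle_count l s n 1 = card {i \<in> {1..n}. card (orbit ?\<sigma> i) = s}"
    unfolding mult_cycle_count[OF assms(2)] unfolding weak_tuples_1
  proof (rule card_orbit_semiconj_image)
    show "?\<sigma> ` {1..n} \<subseteq> {1..n}" using permutes_image[OF \<sigma>] by simp
    show "permutation ?\<sigma>" by (rule permutation_of_cycle)
    show "sym_power n 1 ?\<sigma> [i] = [?\<sigma> i]" if "i \<in> {1..n}" for i
      using that unfolding sym_power_def weak_tuples_1 by simp
  qed (auto simp: inj_on_def)
  also have "{i \<in> {1..n}. card (orbit ?\<sigma> i) = s} =
      (if s = l then {1..l} else if s = 1 then {l<..n} else {})"
  proof -
    have *: "card (orbit ?\<sigma> i) = (if i \<le> l then l else 1)" if "i \<in> {1..n}" for i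
    proof (cases "i \<le> l")
      case True
      then have "i = Suc (i - 1)" "i - 1 < l" using that by auto
      then show ?thesis using card_orbit_cycle_of_list True by metis
    next
      case False
      then have "?\<sigma> i = i" by (intro id_outside_supp) auto
      then have "orbit ?\<sigma> i = {i}" by (simp only: orbit_eq_singleton_iff)
      then show ?thesis using False by simp
    qed
    have "{i \<in> {1..n}. card (orbit ?\<sigma> i) = s} = {i \<in> {1..n}. (if i \<le> l then l else 1) = s}"
      by (intro Collect_cong conj_cong refl) (simp only: *)
    also have "\<dots> = (if s = l then {1..l} else if s = 1 then {l<..n} else {})"
      using assms by (auto split: if_splits)
    finally show ?thesis .
  qed
  finally show ?thesis by auto
qed

section \<open>The recursion for n > l\<close>

lemma weak_tuples_Suc_eq:
  assumes "0 < n"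
  shows "weak_tuples n (Suc k) = weak_tuples (n - 1) (Suc k) \<union> (\<lambda>xs. xs @ [n]) ` weak_tuples n k"
proof (intro equalityI subsetI)
  fix xs assume xs: "xs \<in> weak_tuples n (Suc k)"
  show "xs \<in> weak_tuples (n - 1) (Suc k) \<union> (\<lambda>xs. xs @ [n]) ` weak_tuples n k"
  proof (cases "n \<in> set xs")
    case True
    obtain ys y where ys: "xs = ys @ [y]"
      using xs by (cases xs rule: rev_cases) (auto simp: weak_tuples_def)
    \<comment> \<open>The list is sorted and bounded by \<open>n\<close>, so an occurrence of
      \<open>n\<close> forces its last entry to be \<open>n\<close>.\<close>
    then have "y = n" using True xs by (force simp: weak_tuples_def sorted_append)
    then show ?thesis using xs ys by (auto simp: weak_tuples_def sorted_append)
  next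
    case False
    have "x \<in> {1..n - 1}" if "x \<in> set xs" for x
    proof -
      have "x \<in> {1..n}" "x \<noteq> n" using xs that False by (auto simp: weak_tuples_def)
      then show ?thesis by auto
    qed
    then show ?thesis using xs by (auto simp: weak_tuples_def)
  qed
next
  fix xs assume "xs \<in> weak_tuples (n - 1) (Suc k) \<union> (\<lambda>xs. xs @ [n]) ` weak_tuples n k"
  then show "xs \<in> weak_tuples n (Suc k)"
    using assms by (fastforce simp: weak_tuples_def sorted_append)
qed

lemma card_Collect_Un_disjoint:
  assumes "finite A" "finite B" "A \<inter> B = {}"
  shows "card {x \<in> A \<union> B. P x} = card {x \<in> A. P x} + card {x \<in> B. P x}"
proof -
  have "{x \<in> A \<union> B. P x} = {x \<in> A. P x} \<union> {x \<in> B. P x}" by blast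
  then show ?thesis using assms by (simp add: card_Un_disjoint disjoint_iff)
qed

lemma mult_cycle_count_Suc:
  assumes "l < n"
  shows "s * cycle_count l s n (Suc k) =
    s * cycle_count l s (n - 1) (Suc k) + s * cycle_count l s n k"
proof -
  let ?\<sigma> = "cycle_of_list [1..<Suc l]"
  let ?f = "sym_power n (Suc k) ?\<sigma>"
  let ?P = "\<lambda>f xs. card (orbit f xs) = s"
  let ?A = "weak_tuples (n - 1) (Suc k)" and ?h = "\<lambda>xs. xs @ [n]"
  have \<sigma>: "?\<sigma> permutes {1..n}" "?\<sigma> permutes {1..n - 1}"
    using assms by (intro cycle_of_list_permutes; simp)+
  have W: "weak_tuples n (Suc k) = ?A \<union> ?h ` weak_tuples n k"
    using assms by (intro weak_tuples_Suc_eq) simp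
  have disj: "?A \<inter> ?h ` weak_tuples n k = {}"
    using assms by (auto simp: weak_tuples_def)
  have "?\<sigma> n = n" using assms by (intro id_outside_supp) auto
  then have f_h: "?f (?h xs) = ?h (sym_power n k ?\<sigma> xs)" if "xs \<in> weak_tuples n k" for xs
  proof -
    have "?h xs \<in> weak_tuples n (Suc k)" using that unfolding W by simp
    \<comment> \<open>No image exceeds \<open>n\<close>, so sorting leaves the appended
      \<open>n\<close> at the end.\<close>
    moreover have "sort (map ?\<sigma> xs @ [n]) = sort (map ?\<sigma> xs) @ [n]"
    proof (rule properties_for_sort)
      have "?\<sigma> x \<le> n" if "x \<in> set xs" for x
        using \<open>xs \<in> _\<close> that permutes_in_image[OF \<sigma>(1), of x] unfolding weak_tuples_def by auto
      then show "sorted (sort (map ?\<sigma> xs) @ [n])" by (auto simp: sorted_append simp del: upt_Suc)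
    qed simp
    ultimately show ?thesis using that \<open>?\<sigma> n = n\<close> by (simp add: sym_power_def del: upt_Suc)
  qed
  have "s * cycle_count l s n (Suc k) =
      card {xs \<in> ?A \<union> ?h ` weak_tuples n k. ?P ?f xs}"
    unfolding mult_cycle_count[OF less_imp_le[OF assms]] W ..
  also have "\<dots> = card {xs \<in> ?A. ?P ?f xs} + card {xs \<in> ?h ` weak_tuples n k. ?P ?f xs}"
    using finite_weak_tuples finite_imageI[OF finite_weak_tuples] disj
    by (rule card_Collect_Un_disjoint)
  \<comment> \<open>Writing \<open>?A\<close> as an image under the identity lets the transport
    lemma replace the symmetric power over \<open>n\<close> by the one over \<open>n - 1\<close>;
    the two agree on \<open>?A\<close>.\<close>
  also have "card {xs \<in> ?A. ?P ?f xs} = card {xs \<in> (\<lambda>xs. xs) ` ?A. ?P ?f xs}"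
    by (simp only: image_ident)
  also have "\<dots> = card {xs \<in> ?A. ?P (sym_power (n - 1) (Suc k) ?\<sigma>) xs}"
  proof (rule card_orbit_semiconj_image)
    show "?f xs = sym_power (n - 1) (Suc k) ?\<sigma> xs" if "xs \<in> ?A" for xs
      using that W by (simp add: sym_power_def del: upt_Suc)
  qed (intro inj_on_id2 permutation_sym_power sym_power_image \<sigma>(2))+
  also have "\<dots> = s * cycle_count l s (n - 1) (Suc k)"
    using assms by (intro mult_cycle_count[symmetric]) simp
  also have "card {xs \<in> ?h ` weak_tuples n k. ?P ?f xs} =
      card {xs \<in> weak_tuples n k. ?P (sym_power n k ?\<sigma>) xs}"
    by (intro card_orbit_semiconj_image permutation_sym_power sym_power_image \<sigma>(1) f_h)
      (simp add: inj_on_def)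
  also have "\<dots> = s * cycle_count l s n k"
    using assms by (intro mult_cycle_count[symmetric]) simp
  finally show ?thesis .
qed

section \<open>Multiplicity functions and fixed points of rotations\<close>

text \<open>Passing to multisets forgets the sorting, so iterating the symmetric power amounts to
  iterating \<sigma> on the entries.\<close>

lemma funpow_sym_power:
  assumes \<sigma>: "\<sigma> permutes {1..n}" and xs: "xs \<in> weak_tuples n k"
  shows "(sym_power n k \<sigma> ^^ d) xs \<in> weak_tuples n k"
    and "mset ((sym_power n k \<sigma> ^^ d) xs) = image_mset (\<sigma> ^^ d) (mset xs)"
proof -
  have "(sym_power n k \<sigma> ^^ d) xs \<in> weak_tuples n k \<and>
    mset ((sym_power n k \<sigma> ^^ d) xs) = image_mset (\<sigma> ^^ d) (mset xs)"
  proof (induction d)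
    case (Suc d)
    then show ?case using sym_power_image[OF \<sigma>]
      by (force simp: sym_power_def multiset.map_comp comp_def)
  qed (simp add: xs)
  then show "(sym_power n k \<sigma> ^^ d) xs \<in> weak_tuples n k"
    and "mset ((sym_power n k \<sigma> ^^ d) xs) = image_mset (\<sigma> ^^ d) (mset xs)" by auto
qed

lemma weak_tuples_eq_iff:
  assumes "xs \<in> weak_tuples n k" "ys \<in> weak_tuples n k"
  shows "xs = ys \<longleftrightarrow> mset xs = mset ys"
  using assms by (metis (mono_tags, lifting) mem_Collect_eq properties_for_sort weak_tuples_def)

text \<open>A bijection carries the multiplicity of \<open>x\<close> to \<open>p x\<close>, and
  every point has the form \<open>p x\<close>.\<close>

lemma image_mset_eq_self_iff:
  assumes "bij p"
  shows "image_mset p M = M \<longleftrightarrow> (\<forall>x. count M (p x) = count M x)"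
proof -
  have "count (image_mset p M) (p x) = count M x" for x
  proof -
    have "p -` {p x} = {x}" using assms by (auto simp: bij_def inj_def)
    then show ?thesis by (cases "x \<in># M") (auto simp: count_image_mset not_in_iff)
  qed
  then show ?thesis
    unfolding multiset_eq_iff by (metis assms bij_pointE)
qed

lemma sum_periodic:
  fixes g :: "nat \<Rightarrow> nat"
  shows "(\<Sum>i<q * d. g (i mod d)) = q * (\<Sum>i<d. g i)"
proof -
  have "(\<Sum>i=m * d..<m * d + d. g (i mod d)) = (\<Sum>i<d. g i)" for m
    by (rule sum.reindex_bij_witness[where i = "\<lambda>i. m * d + i" and j = "\<lambda>i. i - m * d"])
      (auto simp: le_iff_add)
  then show ?thesis by (simp add: sum.nat_group[symmetric])
qed

text \<open>Together with \<open>weak_tuples_eqI\<close> and \<open>obtain_weak_tuple\<close>, this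
  identifies weak tuples with multiplicity functions on \<open>{..<l}\<close> of total
  \<open>k\<close>, where residue \<open>i\<close> stands for the entry
  \<open>Suc i\<close>.\<close>

lemma sum_count_weak_tuples:
  assumes "xs \<in> weak_tuples l k"
  shows "(\<Sum>i<l. count (mset xs) (Suc i)) = k"
proof -
  have "(\<Sum>i<l. count (mset xs) (Suc i)) = (\<Sum>i\<in>{1..l}. count (mset xs) i)"
    by (rule sum.reindex_bij_witness[where i = "\<lambda>i. i - 1" and j = Suc]) auto
  also have "\<dots> = (\<Sum>i\<in>set_mset (mset xs). count (mset xs) i)"
    by (rule sum.mono_neutral_right) (use assms in \<open>auto simp: weak_tuples_def\<close>)
  also have "\<dots> = k"
    using assms unfolding size_multiset_overloaded_eq[symmetric] by (simp add: weak_tuples_def)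
  finally show ?thesis .
qed

lemma weak_tuples_eqI:
  assumes "xs \<in> weak_tuples l k" "ys \<in> weak_tuples l k"
    and "\<And>i. i < l \<Longrightarrow> count (mset xs) (Suc i) = count (mset ys) (Suc i)"
  shows "xs = ys"
proof -
  have "count (mset xs) x = count (mset ys) x" for x
  proof (cases "x \<in> {1..l}")
    case True
    then show ?thesis using assms(3)[of "x - 1"] by auto
  next
    case False
    then have "x \<notin> set xs" "x \<notin> set ys" using assms by (auto simp: weak_tuples_def)
    then show ?thesis by (metis count_eq_zero_iff set_mset_mset)
  qed
  then show ?thesis using weak_tuples_eq_iff[OF assms(1,2)] multiset_eqI by blast
qed

lemma obtain_weak_tuple:
  fixes g :: "nat \<Rightarrow> nat"
  assumes "(\<Sum>i<l. g i) = k"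
  obtains xs where "xs \<in> weak_tuples l k" "\<And>i. i < l \<Longrightarrow> count (mset xs) (Suc i) = g i"
proof
  define M where "M = (\<Sum>i<l. replicate_mset (g i) (Suc i))"
  let ?xs = "sorted_list_of_multiset M"
  have count: "count M x = (\<Sum>i<l. if x = Suc i then g i else 0)" for x
    unfolding M_def by (simp add: count_sum)
  have "size M = k" unfolding M_def using assms by (simp add: size_multiset_sum)
  moreover have "set_mset M \<subseteq> {1..l}"
  proof
    fix x assume "x \<in># M"
    then have "(\<Sum>i<l. if x = Suc i then g i else 0) \<noteq> 0"
      unfolding count[symmetric] by simp
    then obtain i where "i \<in> {..<l}" "(if x = Suc i then g i else 0) \<noteq> 0"
      by (rule sum.not_neutral_contains_not_neutral)
    then show "x \<in> {1..l}" by (auto split: if_splits)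
  qed
  ultimately show "?xs \<in> weak_tuples l k"
    unfolding weak_tuples_def
    by (simp flip: size_mset)
  show "count (mset ?xs) (Suc i) = g i" if "i < l" for i
    using that by (simp add: count)
qed

lemma rotation_fixed_iff:
  assumes "xs \<in> weak_tuples l k"
  shows "(sym_power l k (cycle_of_list [1..<Suc l]) ^^ d) xs = xs \<longleftrightarrow>
    (\<forall>i<l. count (mset xs) (Suc ((d + i) mod l)) = count (mset xs) (Suc i))"
proof -
  let ?\<sigma> = "cycle_of_list [1..<Suc l]"
  have \<sigma>: "?\<sigma> permutes {1..l}" by (rule cycle_of_list_permutes) simp
  then have \<sigma>d: "(?\<sigma> ^^ d) permutes {1..l}" by (rule permutes_funpow)
  have "(sym_power l k ?\<sigma> ^^ d) xs = xs \<longleftrightarrow> image_mset (?\<sigma> ^^ d) (mset xs) = mset xs"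
    using weak_tuples_eq_iff[OF funpow_sym_power(1)[OF \<sigma> assms] assms]
      funpow_sym_power(2)[OF \<sigma> assms] by simp
  also have "\<dots> \<longleftrightarrow> (\<forall>x. count (mset xs) ((?\<sigma> ^^ d) x) = count (mset xs) x)"
    by (rule image_mset_eq_self_iff) (rule permutes_bij[OF \<sigma>d])
  also have "\<dots> \<longleftrightarrow> (\<forall>i<l. count (mset xs) ((?\<sigma> ^^ d) (Suc i)) = count (mset xs) (Suc i))"
  proof (intro iffI allI)
    fix x assume *: "\<forall>i<l. count (mset xs) ((?\<sigma> ^^ d) (Suc i)) = count (mset xs) (Suc i)"
    show "count (mset xs) ((?\<sigma> ^^ d) x) = count (mset xs) x"
    proof (cases "x \<in> {1..l}")
      case True
      then have "Suc (x - 1) = x" "x - 1 < l" by auto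
      then show ?thesis using * by metis
    next
      case False
      \<comment> \<open>Points outside \<open>{1..l}\<close> are fixed, so the condition is trivial
        there.\<close>
      then show ?thesis using permutes_not_in[OF \<sigma>d] by metis
    qed
  qed blast
  also have "\<dots> \<longleftrightarrow> (\<forall>i<l. count (mset xs) (Suc ((d + i) mod l)) = count (mset xs) (Suc i))"
    using funpow_cycle_of_list by metis
  finally show ?thesis .
qed

lemma shift_invariant_iff_periodic:
  fixes c :: "nat \<Rightarrow> 'a"
  assumes "d > 0" and l: "l = q * d"
  shows "(\<forall>i<l. c ((d + i) mod l) = c i) \<longleftrightarrow> (\<forall>i<l. c i = c (i mod d))"
proof (intro iffI allI impI)
  fix i assume c: "\<forall>i<l. c ((d + i) mod l) = c i" and i: "i < l"
  \<comment> \<open>Steps of length \<open>d\<close> that stay below \<open>l\<close> never wrap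
    around, so the invariance can be chained from \<open>i mod d\<close> up to
    \<open>i\<close>.\<close>
  have "r + m * d < l \<Longrightarrow> c (r + m * d) = c r" for r m
  proof (induction m)
    case (Suc m)
    have "c ((d + (r + m * d)) mod l) = c (r + m * d)"
      using c[rule_format, of "r + m * d"] Suc.prems by simp
    moreover have "(d + (r + m * d)) mod l = r + Suc m * d"
      using Suc.prems by (simp add: add_ac)
    ultimately show ?case using Suc by simp
  qed simp
  from this[of "i mod d" "i div d"] show "c i = c (i mod d)" using i by simp
next
  fix i assume c: "\<forall>i<l. c i = c (i mod d)" and i: "i < l"
  \<comment> \<open>Because \<open>d\<close> divides \<open>l\<close>, reduction modulo
    \<open>l\<close> preserves the residue modulo \<open>d\<close>.\<close>
  have "(d + i) mod l mod d = i mod d" using l by (simp add: mod_mod_cancel)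
  moreover have "(d + i) mod l < l" using i by simp
  ultimately show "c ((d + i) mod l) = c i" using c i by metis
qed

text \<open>A fixed tuple is \<open>q\<close> copies of one block of \<open>d\<close>
  multiplicities. The block sum must be \<open>k / q\<close>, so there are none unless
  \<open>q dvd k\<close>; otherwise stars and bars counts the blocks.\<close>

lemma card_rotation_fixed:
  assumes d: "d > 0" and l: "l = q * d" and "q > 0"
  shows "card {xs \<in> weak_tuples l k. (sym_power l k (cycle_of_list [1..<Suc l]) ^^ d) xs = xs} =
    (if q dvd k then (k div q + d - 1) choose (k div q) else 0)"
proof -
  let ?c = "\<lambda>xs i. count (mset xs) (Suc i)"
  define F where "F = {xs \<in> weak_tuples l k. \<forall>i<l. ?c xs i = ?c xs (i mod d)}"
  \<comment> \<open>\<open>h\<close> reads off one period; the surjectivity argument below repeats a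
    given block periodically.\<close>
  define h where "h xs = map (?c xs) [0..<d]" for xs
  have "{xs \<in> weak_tuples l k. (sym_power l k (cycle_of_list [1..<Suc l]) ^^ d) xs = xs} = F"
    unfolding F_def
    by (intro Collect_cong conj_cong refl)
      (subst rotation_fixed_iff, assumption, rule shift_invariant_iff_periodic[OF d l])
  moreover have "inj_on h F"
  proof (rule inj_onI)
    fix xs ys assume xy: "xs \<in> F" "ys \<in> F" "h xs = h ys"
    have "?c xs i = ?c ys i" if "i < l" for i
    proof -
      have "h xs ! (i mod d) = h ys ! (i mod d)" using xy by simp
      then have "?c xs (i mod d) = ?c ys (i mod d)" unfolding h_def using d by simp
      then show ?thesis using xy that unfolding F_def by auto
    qed
    then show "xs = ys" using xy weak_tuples_eqI unfolding F_def by blast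
  qed
  moreover have "h ` F = {ys. length ys = d \<and> q * sum_list ys = k}"
  proof (intro equalityI subsetI)
    fix ys assume "ys \<in> h ` F"
    then obtain xs where xs: "xs \<in> F" "ys = h xs" by blast
    have "xs \<in> weak_tuples l k" using xs by (simp add: F_def)
    then have "k = (\<Sum>i<l. ?c xs i)" by (rule sum_count_weak_tuples[symmetric])
    also have "\<dots> = (\<Sum>i<l. ?c xs (i mod d))"
      by (rule sum.cong) (use xs in \<open>auto simp: F_def\<close>)
    also have "\<dots> = q * (\<Sum>i<d. ?c xs i)" unfolding l by (rule sum_periodic)
    also have "(\<Sum>i<d. ?c xs i) = sum_list ys"
      unfolding xs(2) h_def by (simp add: sum_list_distinct_conv_sum_set lessThan_atLeast0)
    finally show "ys \<in> {ys. length ys = d \<and> q * sum_list ys = k}" using xs by (simp add: h_def)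
  next
    fix ys assume ys: "ys \<in> {ys. length ys = d \<and> q * sum_list ys = k}"
    have "(\<Sum>i<l. ys ! (i mod d)) = q * (\<Sum>i<d. ys ! i)" unfolding l by (rule sum_periodic)
    also have "\<dots> = k" using ys by (auto simp: sum_list_sum_nth lessThan_atLeast0)
    finally obtain xs where xs: "xs \<in> weak_tuples l k" "\<And>i. i < l \<Longrightarrow> ?c xs i = ys ! (i mod d)"
      using obtain_weak_tuple by blast
    have dl: "i < l" if "i < d" for i
      using that l \<open>q > 0\<close> by (metis One_nat_def Suc_leI less_le_trans mult_le_mono1 nat_mult_1)
    have "xs \<in> F" using xs dl d by (auto simp: F_def)
    moreover have "ys = h xs"
      using xs(2) dl ys unfolding h_def by (intro nth_equalityI) auto
    ultimately show "ys \<in> h ` F" by blast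
  qed
  ultimately have "card {xs \<in> weak_tuples l k.
      (sym_power l k (cycle_of_list [1..<Suc l]) ^^ d) xs = xs} =
    card {ys. length ys = d \<and> q * sum_list ys = k}"
    using card_image by metis
  also have "\<dots> = (if q dvd k then (k div q + d - 1) choose (k div q) else 0)"
  proof (cases "q dvd k")
    case True
    then have "{ys. length ys = d \<and> q * sum_list ys = k} = {ys. length ys = d \<and> sum_list ys = k div q}"
      using \<open>q > 0\<close> by auto
    then show ?thesis using True card_length_sum_list[of d "k div q"] by simp
  next
    case False
    then have *: "{ys. length ys = d \<and> q * sum_list ys = k} = {}" by auto
    show ?thesis unfolding * using False by simp
  qed
  finally show ?thesis .
qed

section \<open>The closed formula for n = l\<close>

text \<open>The \<open>l\<close>-th power is the identity, so every orbit size divides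
  \<open>l\<close>. A tuple with orbit size \<open>s\<close> is fixed by the \<open>s\<close>-th
  power, and such tuples exist only if \<open>l div s\<close> divides \<open>k\<close>.\<close>

lemma cycle_count_full_not_dvd:
  assumes "\<not> (s dvd l \<and> l div s dvd k)" and "s > 0" and "l > 0"
  shows "cycle_count l s l k = 0"
proof -
  let ?\<sigma> = "cycle_of_list [1..<Suc l]"
  let ?f = "sym_power l k ?\<sigma>"
  have \<sigma>: "?\<sigma> permutes {1..l}" by (rule cycle_of_list_permutes) simp
  have f: "permutation ?f" using \<sigma> by (rule permutation_sym_power)
  have "card (orbit ?f xs) \<noteq> s" if xs: "xs \<in> weak_tuples l k" for xs
  proof
    assume s: "card (orbit ?f xs) = s"
    have "(?f ^^ l) xs = xs"
      unfolding rotation_fixed_iff[OF xs] by simp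
    then have sl: "s dvd l"
      unfolding funpow_eq_self_iff_card_orbit_dvd[OF f] s .
    then have "l = l div s * s" "l div s > 0" using assms by (auto elim!: dvdE)
    have "(?f ^^ s) xs = xs"
      unfolding funpow_eq_self_iff_card_orbit_dvd[OF f] s by simp
    then have "card {xs \<in> weak_tuples l k. (?f ^^ s) xs = xs} \<noteq> 0"
      using xs finite_weak_tuples by (auto simp: card_eq_0_iff)
    then show False
      using card_rotation_fixed[OF \<open>s > 0\<close> \<open>l = l div s * s\<close> \<open>l div s > 0\<close>, of k] assms(1) sl
      by (auto split: if_splits)
  qed
  then have "{xs \<in> weak_tuples l k. card (orbit ?f xs) = s} = {}" by blast
  then have "s * cycle_count l s l k = 0"
    using mult_cycle_count[of l l s k] by (simp only: card.empty order_refl)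
  then show ?thesis using \<open>s > 0\<close> by simp
qed

text \<open>Absorption and symmetry bring the stars-and-bars count into the shape of the binomials
  in the Moebius sum.\<close>

lemma binomial_minus_1_eq:
  assumes "a > 0"
  shows "real ((b + a - 1) choose b) = real a / real (a + b) * real ((a + b) choose a)"
proof -
  have "a * ((a + b) choose a) = (a + b) * ((a + b - 1) choose (a - 1))"
    using assms by (rule times_binomial_minus1_eq)
  also have "(a + b - 1) choose (a - 1) = (b + a - 1) choose b"
    using binomial_symmetric[of "a - 1" "a + b - 1"] assms by (simp add: add.commute)
  finally have "real a * real ((a + b) choose a) = real (a + b) * real ((b + a - 1) choose b)"
    unfolding of_nat_mult[symmetric] by (rule arg_cong)
  then show ?thesis using assms by (simp add: field_simps)
qed

lemma cycle_count_full:
  assumes l: "l = t * s" and k: "k = t * m" and pos: "s > 0" "t > 0"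
  shows "real (cycle_count l s l k) = 1 / real (s + m) *
    (\<Sum>e | e dvd gcd s m. real_of_int (moebius_mu e) * real (((s + m) div e) choose (s div e)))"
proof -
  let ?f = "sym_power l k (cycle_of_list [1..<Suc l])"
  let ?D = "{e. e dvd s}" and ?b = "\<lambda>e. real (((s + m) div e) choose (s div e))"
  have "finite ?D" using pos by (simp add: finite_divisors_nat)
  have f: "permutation ?f" by (intro permutation_sym_power cycle_of_list_permutes) simp
  have fixed: "real (card {xs \<in> weak_tuples l k. (?f ^^ (s div e)) xs = xs}) =
      (if e dvd m then real s / real (s + m) * ?b e else 0)" if e: "e \<in> ?D" for e
  proof -
    obtain a where a: "s = e * a" using e by (auto simp: dvd_def)
    then have pos': "a > 0" "e > 0" using pos by auto
    \<comment> \<open>Here \<open>l = (t * e) * a\<close>, so the tuples fixed by the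
      \<open>a\<close>-th power consist of \<open>t * e\<close> equal blocks of length
      \<open>a\<close>.\<close>
    have "real (card {xs \<in> weak_tuples l k. (?f ^^ a) xs = xs}) =
      real (if t * e dvd k then (k div (t * e) + a - 1) choose (k div (t * e)) else 0)"
      using card_rotation_fixed[of a l "t * e" k] l a pos pos' by (simp add: mult_ac del: upt_Suc)
    also have "\<dots> = (if e dvd m then real s / real (s + m) * ?b e else 0)"
    proof (cases "e dvd m")
      case True
      then obtain b where b: "m = e * b" by (auto simp: dvd_def)
      have "k div (t * e) = b" "t * e dvd k"
        unfolding k b using pos pos' by (simp_all flip: mult.assoc)
      then have "real (if t * e dvd k then (k div (t * e) + a - 1) choose (k div (t * e)) else 0) =
          real ((b + a - 1) choose b)" by simp
      also have "\<dots> = real a / real (a + b) * real ((a + b) choose a)"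
        using pos'(1) by (rule binomial_minus_1_eq)
      \<comment> \<open>The common factor \<open>e\<close> cancels, so this ratio is the same for
        all \<open>e\<close> and can leave the sum.\<close>
      also have "real a / real (a + b) = real s / real (s + m)"
        unfolding a b of_nat_add of_nat_mult using pos' by (simp flip: distrib_left)
      also have "real ((a + b) choose a) = ?b e"
        unfolding a b using pos' by (simp flip: distrib_left)
      finally show ?thesis using True by (simp only: if_True)
    next
      case False
      then show ?thesis using k pos by simp
    qed
    finally show ?thesis using a pos' by simp
  qed
  have "real s * real (cycle_count l s l k) = real (s * cycle_count l s l k)" by simp
  also have "\<dots> = real_of_int (int (card {xs \<in> weak_tuples l k. card (orbit ?f xs) = s}))"
    unfolding mult_cycle_count[OF order_refl] by simp
  also have "\<dots> = (\<Sum>e\<in>?D. real_of_int (moebius_mu e) *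
      real (card {xs \<in> weak_tuples l k. (?f ^^ (s div e)) xs = xs}))"
    unfolding card_orbit_card_eq_sum_moebius_mu[OF f finite_weak_tuples pos(1)] by simp
  also have "\<dots> = (\<Sum>e\<in>?D. real_of_int (moebius_mu e) *
      (if e dvd m then real s / real (s + m) * ?b e else 0))"
    by (rule sum.cong) (simp_all only: fixed)
  \<comment> \<open>Divisors of \<open>s\<close> that do not divide \<open>m\<close> contribute 0,
    which leaves the divisors of the gcd.\<close>
  also have "\<dots> = (\<Sum>e | e dvd gcd s m. real s / real (s + m) * (real_of_int (moebius_mu e) * ?b e))"
    by (rule sum.mono_neutral_cong_right) (use \<open>finite ?D\<close> in auto)
  also have "\<dots> = real s * (1 / real (s + m) *
      (\<Sum>e | e dvd gcd s m. real_of_int (moebius_mu e) * ?b e))"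
    by (simp add: sum_distrib_left mult_ac)
  finally show ?thesis
    by (rule mult_left_cancel[THEN iffD1, rotated]) (use pos in simp)
qed

section \<open>Assembly of the cases\<close>

theorem theorem4p1:
  fixes l s n k :: nat
  assumes "1 \<le> s" and "s \<le> l" and "1 < l" and "l \<le> n" and "1 \<le> k"
  shows "real (cycle_count l s n k) =
    (if k = 1 \<and> s = l then 1
     else if k = 1 \<and> s = 1 then real n - real l
     else if k = 1 \<and> s \<notin> {1, l} then 0
     else if k > 1 \<and> n = l then
       of_bool (s dvd l \<and> (l div s) dvd k) * (real l / (real s * real l + real s * real k)) *
       (\<Sum>e | e dvd gcd s (s * k div l).
          real_of_int (moebius_mu e) * real (((s + s * k div l) div e) choose (s div e)))
     else real (cycle_count l s (n - 1) k) + real (cycle_count l s n (k - 1)))"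
proof -
  consider "k = 1" | "k > 1" "n = l" "s dvd l \<and> l div s dvd k"
    | "k > 1" "n = l" "\<not> (s dvd l \<and> l div s dvd k)" | "k > 1" "n > l"
    using assms by linarith
  then show ?thesis
  proof cases
    case 1
    have "s * cycle_count l s n 1 = (if s = l then l else if s = 1 then n - l else 0)"
      using assms by (intro mult_cycle_count_1)
    then have "cycle_count l s n 1 = (if s = l then 1 else if s = 1 then n - l else 0)"
      using assms by (auto split: if_splits)
    then show ?thesis using 1 assms by (auto simp: of_nat_diff)
  next
    case 2
    \<comment> \<open>Here \<open>t\<close> is \<open>l / s\<close> and \<open>m\<close> is
      \<open>k / t = s * k / l\<close>; in these parameters the prefactor of the statement collapses
      to \<open>1 / (s + m)\<close>.\<close>
    then obtain t m where l: "l = t * s" and k: "k = t * m"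
      using assms by (metis dvd_div_mult_self dvdE)
    have t: "t > 0" using l assms by (cases t) auto
    have m: "s * k div l = m" using l k t assms by (simp add: mult_ac)
    have "real s * real l + real s * real k = real l * real (s + m)"
      unfolding l k by (simp add: algebra_simps)
    then have "real l / (real s * real l + real s * real k) = 1 / real (s + m)"
      using assms by simp
    then show ?thesis
      using cycle_count_full[OF l k _ t] 2 assms unfolding m by simp
  next
    case 3
    then show ?thesis using cycle_count_full_not_dvd[OF 3(3)] assms by simp
  next
    case 4
    have "s * cycle_count l s n (Suc (k - 1)) =
      s * cycle_count l s (n - 1) (Suc (k - 1)) + s * cycle_count l s n (k - 1)"
      using 4 by (intro mult_cycle_count_Suc)
    \<comment> \<open>As \<open>k > 1\<close>, \<open>Suc (k - 1)\<close> is \<open>k\<close>; the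
      recursion for points becomes one for cycles on cancelling \<open>s > 0\<close>.\<close>
    then have "s * cycle_count l s n k =
      s * (cycle_count l s (n - 1) k + cycle_count l s n (k - 1))"
      using 4 by (simp add: distrib_left)
    then have "cycle_count l s n k = cycle_count l s (n - 1) k + cycle_count l s n (k - 1)"
      using assms by simp
    then show ?thesis using 4 by simp
  qed
qed

end
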